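(* Let $n\ge 2$, let $\lambda: M^{n-1}\to\Lambda^{2n-1}$ be a Legendre submanifold and let $\beta$ be a Lie sphere transformation. (a) If $\lambda$ is Dupin, then $\beta\lambda$ is Dupin. (b) If $\lambda$ is proper Dupin, then $\beta\lambda$ is proper Dupin.
   Context: Let $\mathbf{R}^{n+3}_2$ be $\mathbf{R}^{n+3}$ with the Lie scalar product $\langle x,y\rangle=-x_1y_1+x_2y_2+\cdots+x_{n+2}y_{n+2}-x_{n+3}y_{n+3}$, of signature $(n+1,2)$. For a nonzero vector $x$, $[x]$ denotes its class in real projective space $\mathbf{P}^{n+2}$. The Lie quadric is $Q^{n+1}=\{[x]\in\mathbf{P}^{n+2}:\langle x,x\rangle=0\}$. $\Lambda^{2n-1}$ denotes the set of projective lines of $\mathbf{P}^{n+2}$ contained in $Q^{n+1}$, a smooth manifold of dimension $2n-1$; its smooth structure is the one making the bijection $(p,\xi)\mapsto[(1,p,0),(0,\xi,1)]$ from the unit tangent bundle $T_1S^n=\{(p,\xi)\in S^n\times S^n: p\cdot\xi=0\}$ to $\Lambda^{2n-1}$ a diffeomorphism. Here $[a,b]$ is the projective line through $[a]$ and $[b]$. A Legendre submanifold is a smooth map $\lambda:M^{n-1}\to\Lambda^{2n-1}$ from an $(n-1)$-dimensional smooth manifold that can be written $\lambda=[Z_1,Z_{n+3}]$ with smooth maps $Z_1,Z_{n+3}:M^{n-1}\to\mathbf{R}^{n+3}_2$ such that: (1) for each $x$, $Z_1(x),Z_{n+3}(x)$ are linearly independent, and $\langle Z_1,Z_1\rangle=\langle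 Z_{n+3},Z_{n+3}\rangle=\langle Z_1,Z_{n+3}\rangle=0$; (2) there is no nonzero tangent vector $X$ at any $x\in M^{n-1}$ such that $dZ_1(X)$ and $dZ_{n+3}(X)$ both lie in $\mathrm{Span}\{Z_1(x),Z_{n+3}(x)\}$; (3) $\langle dZ_1,Z_{n+3}\rangle=0$. These conditions do not depend on the choice of smooth frame $Z_1,Z_{n+3}$. For $r,s\in\mathbf{R}$ not both zero, the point $[K]=[rZ_1(x)+sZ_{n+3}(x)]$ of the line $\lambda(x)$ is a curvature sphere of $\lambda$ at $x$ if there is a nonzero $X\in T_xM^{n-1}$ with $r\,dZ_1(X)+s\,dZ_{n+3}(X)\in\mathrm{Span}\{Z_1(x),Z_{n+3}(x)\}$. The set of all $X\in T_xM^{n-1}$ satisfying this membership (a linear subspace) is the principal space corresponding to $[K]$. These notions do not depend on the choice of $Z_1,Z_{n+3}$. At each $x$ there are finitely many (at most $n-1$) curvature spheres, and $T_xM^{n-1}$ is the direct sum of the corresponding principal spaces. A curvature surface of $\lambda$ is a connected submanifold $S\subset M^{n-1}$ such that for each $x\in S$ the tangent space $T_xS$ equals the principal space of some curvature sphere of $\lambda$ at $x$; assigning to $x\in S$ that (unique) curvature sphere gives the corresponding curvature sphere map $S\to Q^{n+1}$. The Legendre submanifold $\lambda$ is Dupin if along each curvature surface the corresponding curvature sphere map is constant. It is proper Dupin if it is Dupin and, in addition, the number $g$ of distinct curvature spheres at a point is constant on $M^{n-1}$. A Lie sphere transformation $\beta$ is a projective transformation of $\mathbf{P}^{n+2}$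 mapping $Q^{n+1}$ to itself; every such $\beta$ is induced by some linear $B\in O(n+1,2)$, the orthogonal group of $\langle\ ,\ \rangle$, i.e. $\beta[x]=[Bx]$. If $\lambda=[Z_1,Z_{n+3}]$, then $\beta\lambda:M^{n-1}\to\Lambda^{2n-1}$ denotes the Legendre submanifold $[BZ_1,BZ_{n+3}]$. *)

theory Defs
  imports "HOL-Analysis.Analysis"
begin

section \<open>Smooth manifolds\<close>

primrec Ck_on :: "nat \<Rightarrow> 'a::real_normed_vector set \<Rightarrow> ('a \<Rightarrow> 'b::real_normed_vector) \<Rightarrow> bool" where
  "Ck_on 0 U f \<longleftrightarrow> continuous_on U f"
| "Ck_on (Suc k) U f \<longleftrightarrow>
     (\<forall>x\<in>U. f differentiable (at x)) \<and> (\<forall>v. Ck_on k U (\<lambda>x. frechet_derivative f (at x) v))"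

text \<open>This is only used on open sets \<open>U\<close>.\<close>

definition smooth_on :: "'a::real_normed_vector set \<Rightarrow> ('a \<Rightarrow> 'b::real_normed_vector) \<Rightarrow> bool" where
  "smooth_on U f \<longleftrightarrow> (\<forall>k. Ck_on k U f)"

text \<open>A chart is a pair of a domain and a map; the values of the map outside of the domain are
  irrelevant. The dimension of a manifold is \<open>DIM('e)\<close>. The atlas is not required to be maximal;
  \<open>smooth_charts\<close> is the maximal atlas that it generates.\<close>

type_synonym ('p, 'e) chart = "'p set \<times> ('p \<Rightarrow> 'e)"

record ('p, 'e) manifold =
  mtop :: "'p topology"
  atlas :: "('p, 'e) chart set"

abbreviation points :: "('p, 'e) manifold \<Rightarrow> 'p set" where
  "points M \<equiv> topspace (mtop M)"

definition chart_inv :: "('p, 'e) chart \<Rightarrow> 'e \<Rightarrow> 'p" where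
  "chart_inv c = inv_into (fst c) (snd c)"

definition is_chart :: "'p topology \<Rightarrow> ('p, 'e::euclidean_space) chart \<Rightarrow> bool" where
  "is_chart T c \<longleftrightarrow> openin T (fst c) \<and> open (snd c ` fst c) \<and>
     homeomorphic_map (subtopology T (fst c)) (top_of_set (snd c ` fst c)) (snd c)"

definition smoothly_compatible ::
    "('p, 'e::euclidean_space) chart \<Rightarrow> ('p, 'e) chart \<Rightarrow> bool" where
  "smoothly_compatible c d \<longleftrightarrow>
     smooth_on (snd c ` (fst c \<inter> fst d)) (snd d \<circ> chart_inv c) \<and>
     smooth_on (snd d ` (fst c \<inter> fst d)) (snd c \<circ> chart_inv d)"

definition smooth_manifold :: "('p, 'e::euclidean_space) manifold \<Rightarrow> bool" where
  "smooth_manifold M \<longleftrightarrow>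
     Hausdorff_space (mtop M) \<and> second_countable (mtop M) \<and>
     (\<forall>c\<in>atlas M. is_chart (mtop M) c) \<and>
     (\<Union>c\<in>atlas M. fst c) = points M \<and>
     (\<forall>c\<in>atlas M. \<forall>d\<in>atlas M. smoothly_compatible c d)"

definition smooth_charts :: "('p, 'e::euclidean_space) manifold \<Rightarrow> ('p, 'e) chart set" where
  "smooth_charts M = {c. is_chart (mtop M) c \<and> (\<forall>d\<in>atlas M. smoothly_compatible c d)}"

definition charts_at :: "('p, 'e::euclidean_space) manifold \<Rightarrow> 'p \<Rightarrow> ('p, 'e) chart set" where
  "charts_at M x = {c \<in> smooth_charts M. x \<in> fst c}"

definition smooth_map ::
    "('p, 'e::euclidean_space) manifold \<Rightarrow> ('p \<Rightarrow> 'b::real_normed_vector) \<Rightarrow> bool" where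
  "smooth_map M f \<longleftrightarrow> (\<forall>c\<in>smooth_charts M. smooth_on (snd c ` fst c) (f \<circ> chart_inv c))"

text \<open>A tangent vector at \<open>x\<close> is the family of its coordinate vectors in all the charts around \<open>x\<close>;
  the coordinate vectors transform by the derivatives of the coordinate changes. The value \<open>0\<close> on
  all other charts is a convention that makes \<open>\<lambda>_. 0\<close> the zero tangent vector.\<close>

type_synonym ('p, 'e) tangent_vector = "('p, 'e) chart \<Rightarrow> 'e"

definition tangent_space ::
    "('p, 'e::euclidean_space) manifold \<Rightarrow> 'p \<Rightarrow> ('p, 'e) tangent_vector set" where
  "tangent_space M x = {X.
     (\<forall>c. c \<notin> charts_at M x \<longrightarrow> X c = 0) \<and>
     (\<forall>c\<in>charts_at M x. \<forall>d\<in>charts_at M x.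
        X d = frechet_derivative (snd d \<circ> chart_inv c) (at (snd c x)) (X c))}"

definition zero_tangent :: "('p, 'e::euclidean_space) tangent_vector" where
  "zero_tangent = (\<lambda>_. 0)"

text \<open>By the chain rule, the differential does not depend on the choice of the chart.\<close>

definition differential ::
    "('p, 'e::euclidean_space) manifold \<Rightarrow> ('p \<Rightarrow> 'b::real_normed_vector) \<Rightarrow> 'p \<Rightarrow>
     ('p, 'e) tangent_vector \<Rightarrow> 'b" where
  "differential M f x X =
     (let c = (SOME c. c \<in> charts_at M x)
      in frechet_derivative (f \<circ> chart_inv c) (at (snd c x)) (X c))"

text \<open>Submanifolds are embedded submanifolds, described by slice charts.\<close>

definition slice_chart ::
    "('p, 'e::euclidean_space) manifold \<Rightarrow> 'p set \<Rightarrow> ('p, 'e) chart \<Rightarrow> 'e set \<Rightarrow> bool" where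
  "slice_chart M S c L \<longleftrightarrow>
     c \<in> smooth_charts M \<and> subspace L \<and> snd c ` (S \<inter> fst c) = snd c ` fst c \<inter> L"

definition submanifold :: "('p, 'e::euclidean_space) manifold \<Rightarrow> 'p set \<Rightarrow> bool" where
  "submanifold M S \<longleftrightarrow> S \<subseteq> points M \<and>
     (\<exists>k. \<forall>x\<in>S. \<exists>c L. slice_chart M S c L \<and> x \<in> fst c \<and> dim L = k)"

definition submanifold_tangent_space ::
    "('p, 'e::euclidean_space) manifold \<Rightarrow> 'p set \<Rightarrow> 'p \<Rightarrow> ('p, 'e) tangent_vector set" where
  "submanifold_tangent_space M S x =
     {X \<in> tangent_space M x. \<exists>c L. slice_chart M S c L \<and> x \<in> fst c \<and> X c \<in> L}"

section \<open>The Lie quadric and the manifold of projective lines on it\<close>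

text \<open>With \<open>CARD('k) = n + 1\<close>, the type \<open>'k lie_vec\<close> is the space of all
  \<open>x = (x\<^sub>1, (x\<^sub>2, \<dots>, x\<^sub>n\<^sub>+\<^sub>2), x\<^sub>n\<^sub>+\<^sub>3)\<close>.\<close>

type_synonym 'k lie_vec = "real \<times> (real ^ 'k) \<times> real"

fun lie :: "'k::finite lie_vec \<Rightarrow> 'k lie_vec \<Rightarrow> real" where
  "lie (x1, x, x3) (y1, y, y3) = - x1 * y1 + x \<bullet> y - x3 * y3"

text \<open>A point of projective space is a line through the origin, and a projective line is a set of
  points of projective space.\<close>

type_synonym 'k proj_point = "'k lie_vec set"
type_synonym 'k proj_line = "'k proj_point set"

definition proj :: "'k::finite lie_vec \<Rightarrow> 'k proj_point" where
  "proj x = span {x}"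

definition lie_quadric :: "'k::finite proj_point set" where
  "lie_quadric = {proj x |x. x \<noteq> 0 \<and> lie x x = 0}"

definition line_through :: "'k::finite lie_vec \<Rightarrow> 'k lie_vec \<Rightarrow> 'k proj_line" where
  "line_through a b = {proj v |v. v \<in> span {a, b} \<and> v \<noteq> 0}"

definition lin_indep2 :: "'a::real_vector \<Rightarrow> 'a \<Rightarrow> bool" where
  "lin_indep2 a b \<longleftrightarrow> a \<noteq> b \<and> independent {a, b}"

definition Lambda :: "'k::finite proj_line set" where
  "Lambda = {line_through a b |a b. lin_indep2 a b \<and> line_through a b \<subseteq> lie_quadric}"

definition unit_tangent_bundle :: "((real ^ 'k::finite) \<times> (real ^ 'k)) set" where
  "unit_tangent_bundle = {(p, \<xi>). norm p = 1 \<and> norm \<xi> = 1 \<and> p \<bullet> \<xi> = 0}"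

definition contact_line :: "(real ^ 'k::finite) \<times> (real ^ 'k) \<Rightarrow> 'k proj_line" where
  "contact_line e = line_through (1, fst e, 0) (0, snd e, 1)"

text \<open>The smooth structure of \<open>Lambda\<close> is transported from the unit tangent bundle by the bijection
  \<open>contact_line\<close>. As the unit tangent bundle is an embedded submanifold of the vector space of all
  pairs \<open>(p, \<xi>)\<close>, a map into it is smooth iff it is smooth as a map into this vector space.\<close>

definition smooth_map_Lambda ::
    "('p, 'e::euclidean_space) manifold \<Rightarrow> ('p \<Rightarrow> 'k::finite proj_line) \<Rightarrow> bool" where
  "smooth_map_Lambda M lam \<longleftrightarrow>
     lam ` points M \<subseteq> Lambda \<and>
     smooth_map M (\<lambda>x. inv_into unit_tangent_bundle contact_line (lam x))"

section \<open>Legendre submanifolds, curvature spheres and the Dupin condition\<close>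

definition legendre_frame ::
    "('p, 'e::euclidean_space) manifold \<Rightarrow> ('p \<Rightarrow> 'k::finite proj_line) \<Rightarrow>
     ('p \<Rightarrow> 'k lie_vec) \<Rightarrow> ('p \<Rightarrow> 'k lie_vec) \<Rightarrow> bool" where
  "legendre_frame M lam Z1 Z3 \<longleftrightarrow>
     smooth_map M Z1 \<and> smooth_map M Z3 \<and>
     (\<forall>x\<in>points M. lam x = line_through (Z1 x) (Z3 x)) \<and>
     (\<forall>x\<in>points M. lin_indep2 (Z1 x) (Z3 x) \<and>
        lie (Z1 x) (Z1 x) = 0 \<and> lie (Z3 x) (Z3 x) = 0 \<and> lie (Z1 x) (Z3 x) = 0) \<and>
     (\<forall>x\<in>points M. \<not> (\<exists>X\<in>tangent_space M x. X \<noteq> zero_tangent \<and>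
        differential M Z1 x X \<in> span {Z1 x, Z3 x} \<and>
        differential M Z3 x X \<in> span {Z1 x, Z3 x})) \<and>
     (\<forall>x\<in>points M. \<forall>X\<in>tangent_space M x. lie (differential M Z1 x X) (Z3 x) = 0)"

definition legendre_submanifold ::
    "('p, 'e::euclidean_space) manifold \<Rightarrow> ('p \<Rightarrow> 'k::finite proj_line) \<Rightarrow> bool" where
  "legendre_submanifold M lam \<longleftrightarrow>
     smooth_map_Lambda M lam \<and> (\<exists>Z1 Z3. legendre_frame M lam Z1 Z3)"

text \<open>The following two notions do not depend on the choice of the frame \<open>Z1\<close>, \<open>Z3\<close>.\<close>

definition curvature_sphere ::
    "('p, 'e::euclidean_space) manifold \<Rightarrow> ('p \<Rightarrow> 'k::finite proj_line) \<Rightarrow> 'p \<Rightarrow>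
     'k proj_point \<Rightarrow> bool" where
  "curvature_sphere M lam x \<kappa> \<longleftrightarrow>
     (\<exists>Z1 Z3 r s. legendre_frame M lam Z1 Z3 \<and> (r, s) \<noteq> (0, 0) \<and>
        \<kappa> = proj (r *\<^sub>R Z1 x + s *\<^sub>R Z3 x) \<and>
        (\<exists>X\<in>tangent_space M x. X \<noteq> zero_tangent \<and>
           r *\<^sub>R differential M Z1 x X + s *\<^sub>R differential M Z3 x X \<in> span {Z1 x, Z3 x}))"

definition principal_space ::
    "('p, 'e::euclidean_space) manifold \<Rightarrow> ('p \<Rightarrow> 'k::finite proj_line) \<Rightarrow> 'p \<Rightarrow>
     'k proj_point \<Rightarrow> ('p, 'e) tangent_vector set" where
  "principal_space M lam x \<kappa> = {X \<in> tangent_space M x.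
     \<exists>Z1 Z3 r s. legendre_frame M lam Z1 Z3 \<and> (r, s) \<noteq> (0, 0) \<and>
        \<kappa> = proj (r *\<^sub>R Z1 x + s *\<^sub>R Z3 x) \<and>
        r *\<^sub>R differential M Z1 x X + s *\<^sub>R differential M Z3 x X \<in> span {Z1 x, Z3 x}}"

definition curvature_surface ::
    "('p, 'e::euclidean_space) manifold \<Rightarrow> ('p \<Rightarrow> 'k::finite proj_line) \<Rightarrow> 'p set \<Rightarrow> bool" where
  "curvature_surface M lam S \<longleftrightarrow>
     submanifold M S \<and> connectedin (mtop M) S \<and>
     (\<forall>x\<in>S. \<exists>\<kappa>. curvature_sphere M lam x \<kappa> \<and>
        submanifold_tangent_space M S x = principal_space M lam x \<kappa>)"

definition curvature_sphere_map ::
    "('p, 'e::euclidean_space) manifold \<Rightarrow> ('p \<Rightarrow> 'k::finite proj_line) \<Rightarrow> 'p set \<Rightarrow> 'p \<Rightarrow>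
     'k proj_point" where
  "curvature_sphere_map M lam S x =
     (THE \<kappa>. curvature_sphere M lam x \<kappa> \<and>
        submanifold_tangent_space M S x = principal_space M lam x \<kappa>)"

definition dupin ::
    "('p, 'e::euclidean_space) manifold \<Rightarrow> ('p \<Rightarrow> 'k::finite proj_line) \<Rightarrow> bool" where
  "dupin M lam \<longleftrightarrow> legendre_submanifold M lam \<and>
     (\<forall>S. curvature_surface M lam S \<longrightarrow> curvature_sphere_map M lam S constant_on S)"

definition proper_dupin ::
    "('p, 'e::euclidean_space) manifold \<Rightarrow> ('p \<Rightarrow> 'k::finite proj_line) \<Rightarrow> bool" where
  "proper_dupin M lam \<longleftrightarrow> dupin M lam \<and>
     (\<exists>g. \<forall>x\<in>points M. finite {\<kappa>. curvature_sphere M lam x \<kappa>} \<and>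
        card {\<kappa>. curvature_sphere M lam x \<kappa>} = g)"

section \<open>Lie sphere transformations\<close>

definition induced_by ::
    "('k::finite proj_point \<Rightarrow> 'k proj_point) \<Rightarrow> ('k lie_vec \<Rightarrow> 'k lie_vec) \<Rightarrow> bool" where
  "induced_by \<beta> B \<longleftrightarrow> linear B \<and> bij B \<and> (\<forall>x. x \<noteq> 0 \<longrightarrow> \<beta> (proj x) = proj (B x))"

definition lie_sphere_transformation :: "('k::finite proj_point \<Rightarrow> 'k proj_point) \<Rightarrow> bool" where
  "lie_sphere_transformation \<beta> \<longleftrightarrow> (\<exists>B. induced_by \<beta> B) \<and> \<beta> ` lie_quadric = lie_quadric"

text \<open>The transform of \<open>lam\<close> takes each projective line \<open>lam x\<close> to its image under \<open>\<beta>\<close>. By the lemma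
  below, the transform of \<open>[Z1, Z3]\<close> is \<open>[B Z1, B Z3]\<close> for every \<open>B\<close> that induces \<open>\<beta>\<close>.\<close>

definition lie_transform ::
    "('k::finite proj_point \<Rightarrow> 'k proj_point) \<Rightarrow> ('p \<Rightarrow> 'k proj_line) \<Rightarrow> 'p \<Rightarrow> 'k proj_line" where
  "lie_transform \<beta> lam x = \<beta> ` lam x"

lemma lie_transform_line_through:
  assumes B: "induced_by \<beta> B" and x: "lam x = line_through (Z1 x) (Z3 x)"
  shows "lie_transform \<beta> lam x = line_through (B (Z1 x)) (B (Z3 x))"
proof -
  from B have lin: "linear B" and inj: "inj B"
    and \<beta>: "\<And>v. v \<noteq> 0 \<Longrightarrow> \<beta> (proj v) = proj (B v)"
    by (auto simp: induced_by_def bij_is_inj)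
  have nz: "B v = 0 \<longleftrightarrow> v = 0" for v
    using inj linear_0[OF lin] by (metis injD)
  have sp: "span {B (Z1 x), B (Z3 x)} = B ` span {Z1 x, Z3 x}"
    using linear_span_image[OF lin, of "{Z1 x, Z3 x}"] by simp
  show ?thesis
    unfolding lie_transform_def x line_through_def sp
  proof (intro subset_antisym subsetI)
    fix q assume "q \<in> \<beta> ` {proj v |v. v \<in> span {Z1 x, Z3 x} \<and> v \<noteq> 0}"
    then obtain v where "v \<in> span {Z1 x, Z3 x}" "v \<noteq> 0" "q = proj (B v)"
      using \<beta> by blast
    then show "q \<in> {proj v |v. v \<in> B ` span {Z1 x, Z3 x} \<and> v \<noteq> 0}"
      using nz by blast
  next
    fix q assume "q \<in> {proj v |v. v \<in> B ` span {Z1 x, Z3 x} \<and> v \<noteq> 0}"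
    then obtain v where v: "v \<in> span {Z1 x, Z3 x}" "B v \<noteq> 0" "q = proj (B v)"
      by blast
    then have "v \<noteq> 0" "q = \<beta> (proj v)"
      using nz \<beta> by metis+
    then show "q \<in> \<beta> ` {proj v |v. v \<in> span {Z1 x, Z3 x} \<and> v \<noteq> 0}"
      using v(1) by blast
  qed
qed

end

theory Submission
  imports Defs
begin

text \<open>A linear map inducing a Lie sphere transformation preserves the null cone, hence rescales the Lie
  product by a constant, so it sends Legendre frames of \<open>\<lambda>\<close> to Legendre frames of \<open>\<beta>\<lambda>\<close>. As it
  commutes with differentials, it maps the curvature spheres bijectively to those of \<open>\<beta>\<lambda>\<close> and keeps
  the principal spaces, hence also the curvature surfaces. The curvature sphere map is a definite
  description, so one also needs that a principal space determines its curvature sphere. As two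
  Legendre frames differ by smooth coefficients, this reduces to a single frame, where two distinct
  curvature spheres with a common principal vector would contradict the immersion condition.\<close>

section \<open>Calculus of smooth maps\<close>

lemma frechet_derivative_cong_open:
  assumes "open U" "x \<in> U" "\<And>y. y \<in> U \<Longrightarrow> f y = g y"
  shows "frechet_derivative f (at x) = frechet_derivative g (at x)"
proof -
  \<comment> \<open>As both functions have the same candidates \<open>D\<close>, the choice operator
    in \<open>frechet_derivative\<close> picks the same map, even at points without a
    derivative.\<close>
  have "(f has_derivative D) (at x) \<longleftrightarrow> (g has_derivative D) (at x)" for D
    using assms has_derivative_transform_within_open[of f D x UNIV U g]
      has_derivative_transform_within_open[of g D x UNIV U f] by auto
  then show ?thesis
    unfolding frechet_derivative_def by presburger
qed

lemma Ck_on_cong: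
  assumes "open U" "\<And>x. x \<in> U \<Longrightarrow> f x = g x"
  shows "Ck_on k U f \<longleftrightarrow> Ck_on k U g"
  using assms(2)
proof (induction k arbitrary: f g)
  case 0
  then show ?case by (auto cong: continuous_on_cong)
next
  case (Suc k)
  have "f differentiable (at x) \<longleftrightarrow> g differentiable (at x)" if "x \<in> U" for x
    using that Suc.prems assms(1) unfolding differentiable_def
    by (metis has_derivative_transform_within_open)
  moreover have "Ck_on k U (\<lambda>x. frechet_derivative f (at x) v) \<longleftrightarrow>
      Ck_on k U (\<lambda>x. frechet_derivative g (at x) v)" for v
    using Suc.prems frechet_derivative_cong_open[OF assms(1), of _ f g] by (intro Suc.IH) auto
  ultimately show ?case by auto
qed

text \<open>Lets each closure proof name an explicit derivative \<open>f'\<close>: it agrees with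
  \<open>frechet_derivative\<close> on the open set \<open>U\<close>, which is all that
  \<open>Ck_on\<close> sees.\<close>

lemma Ck_on_SucI:
  assumes "open U" "\<And>x. x \<in> U \<Longrightarrow> (f has_derivative f' x) (at x)"
    and "\<And>v. Ck_on k U (\<lambda>x. f' x v)"
  shows "Ck_on (Suc k) U f"
proof -
  have "frechet_derivative f (at x) = f' x" if "x \<in> U" for x
    using frechet_derivative_at[OF assms(2)[OF that]] by simp
  then have "Ck_on k U (\<lambda>x. frechet_derivative f (at x) v)" for v
    using Ck_on_cong[OF assms(1), of "\<lambda>x. frechet_derivative f (at x) v" "\<lambda>x. f' x v" k] assms(3)
    by simp
  then show ?thesis
    using assms(2) by (auto simp: differentiable_def)
qed

lemma Ck_on_SucD:
  assumes "Ck_on (Suc k) U f"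
  shows "\<And>x. x \<in> U \<Longrightarrow> (f has_derivative frechet_derivative f (at x)) (at x)"
    and "\<And>v. Ck_on k U (\<lambda>x. frechet_derivative f (at x) v)"
  using assms by (auto simp: frechet_derivative_works)

lemma Ck_on_Suc_imp: "Ck_on (Suc k) U f \<Longrightarrow> Ck_on k U f"
proof (induction k arbitrary: f)
  case 0
  then show ?case
    by (auto intro!: continuous_at_imp_continuous_on differentiable_imp_continuous_within)
next
  case (Suc k)
  then show ?case
    by (metis Ck_on.simps(2))
qed

lemma Ck_on_const: "open U \<Longrightarrow> Ck_on k U (\<lambda>x. c)"
proof (induction k arbitrary: c)
  case (Suc k)
  then show ?case
    by (intro Ck_on_SucI[where f' = "\<lambda>x v. 0"]) auto
qed auto

lemma Ck_on_add:
  assumes "open U" "Ck_on k U f" "Ck_on k U g"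
  shows "Ck_on k U (\<lambda>x. f x + g x)"
  using assms(2,3)
proof (induction k arbitrary: f g)
  case 0
  then show ?case by (auto intro: continuous_on_add)
next
  case (Suc k)
  note f = Ck_on_SucD[OF Suc.prems(1)] and g = Ck_on_SucD[OF Suc.prems(2)]
  show ?case
    using assms(1) f g
    by (intro Ck_on_SucI[where
          f' = "\<lambda>x v. frechet_derivative f (at x) v + frechet_derivative g (at x) v"])
      (auto intro: has_derivative_add Suc.IH)
qed

lemma Ck_on_bounded_linear:
  assumes "bounded_linear L" "open U" "Ck_on k U f"
  shows "Ck_on k U (\<lambda>x. L (f x))"
  using assms(3)
proof (induction k arbitrary: f)
  case 0
  then show ?case by (auto intro: bounded_linear.continuous_on[OF assms(1)])
next
  case (Suc k)
  note f = Ck_on_SucD[OF Suc.prems]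
  show ?case
    using assms f
    by (intro Ck_on_SucI[where f' = "\<lambda>x v. L (frechet_derivative f (at x) v)"])
      (auto intro: bounded_linear.has_derivative Suc.IH)
qed

text \<open>By the product rule the derivative is a sum of two terms of the same shape. In each of
  them one factor stays undifferentiated, so its regularity has to be lowered by
  \<open>Ck_on_Suc_imp\<close> before the induction hypothesis applies.\<close>

lemma Ck_on_bounded_bilinear:
  assumes "bounded_bilinear b" "open U" "Ck_on k U f" "Ck_on k U g"
  shows "Ck_on k U (\<lambda>x. b (f x) (g x))"
  using assms(3,4)
proof (induction k arbitrary: f g)
  case 0
  then show ?case by (auto intro: bounded_bilinear.continuous_on[OF assms(1)])
next
  case (Suc k)
  note f = Ck_on_SucD[OF Suc.prems(1)] and g = Ck_on_SucD[OF Suc.prems(2)]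
  note f0 = Ck_on_Suc_imp[OF Suc.prems(1)] and g0 = Ck_on_Suc_imp[OF Suc.prems(2)]
  show ?case
  proof (rule Ck_on_SucI[OF assms(2)])
    show "((\<lambda>x. b (f x) (g x)) has_derivative
        (\<lambda>v. b (f x) (frechet_derivative g (at x) v) + b (frechet_derivative f (at x) v) (g x)))
        (at x)" if "x \<in> U" for x
      using bounded_bilinear.FDERIV[OF assms(1)] f(1) g(1) that by blast
    show "Ck_on k U (\<lambda>x. b (f x) (frechet_derivative g (at x) v) +
        b (frechet_derivative f (at x) v) (g x))" for v
      using f(2) g(2) f0 g0 by (intro Ck_on_add assms(2) Suc.IH)
  qed
qed

text \<open>The derivative of the reciprocal is again built from the reciprocal, which is of class
  C^k by the induction hypothesis, and from the derivative of \<open>f\<close>.\<close>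

lemma Ck_on_inverse:
  fixes f :: "'a::real_normed_vector \<Rightarrow> real"
  assumes "open U" "\<And>x. x \<in> U \<Longrightarrow> f x \<noteq> 0" "Ck_on k U f"
  shows "Ck_on k U (\<lambda>x. inverse (f x))"
  using assms(3)
proof (induction k)
  case 0
  then show ?case using assms(2) by (auto intro: continuous_on_inverse)
next
  case (Suc k)
  note f = Ck_on_SucD[OF Suc.prems]
  have inv: "Ck_on k U (\<lambda>x. inverse (f x))"
    using Suc Ck_on_Suc_imp by blast
  show ?case
  proof (rule Ck_on_SucI[OF assms(1)])
    show "((\<lambda>x. inverse (f x)) has_derivative
        (\<lambda>v. - (inverse (f x) * frechet_derivative f (at x) v * inverse (f x)))) (at x)"
      if "x \<in> U" for x
      using Deriv.has_derivative_inverse[OF assms(2)[OF that] f(1)[OF that]] .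
    show "Ck_on k U (\<lambda>x. - (inverse (f x) * frechet_derivative f (at x) v * inverse (f x)))" for v
      using inv f(2)
      by (intro Ck_on_bounded_linear[OF bounded_linear_minus[OF bounded_linear_ident]]
          Ck_on_bounded_bilinear[OF bounded_bilinear_mult] assms(1))
  qed
qed

section \<open>Smooth maps on a manifold, read in charts\<close>

lemma smooth_chart_open: "c \<in> smooth_charts M \<Longrightarrow> open (snd c ` fst c)"
  by (auto simp: smooth_charts_def is_chart_def)

lemma chart_inv_in:
  assumes "c \<in> smooth_charts M" "y \<in> snd c ` fst c"
  shows "chart_inv c y \<in> points M"
  using assms inv_into_into[of y "snd c" "fst c"] openin_subset
  by (fastforce simp: smooth_charts_def is_chart_def chart_inv_def)

lemma chart_inv_apply:
  assumes "c \<in> smooth_charts M" "x \<in> fst c"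
  shows "chart_inv c (snd c x) = x"
proof -
  have "fst c \<subseteq> points M"
    using assms by (auto simp: smooth_charts_def is_chart_def dest: openin_subset)
  then have "inj_on (snd c) (fst c)"
    using assms homeomorphic_imp_injective_map
    by (fastforce simp: smooth_charts_def is_chart_def Int_absorb1)
  then show ?thesis
    using assms by (simp add: chart_inv_def)
qed

lemma smooth_mapI:
  assumes "\<And>c k. c \<in> smooth_charts M \<Longrightarrow> open (snd c ` fst c) \<Longrightarrow>
    Ck_on k (snd c ` fst c) (\<lambda>y. f (chart_inv c y))"
  shows "smooth_map M f"
  using assms smooth_chart_open unfolding smooth_map_def smooth_on_def comp_def by blast

lemma smooth_mapD:
  "smooth_map M f \<Longrightarrow> c \<in> smooth_charts M \<Longrightarrow> Ck_on k (snd c ` fst c) (\<lambda>y. f (chart_inv c y))"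
  by (auto simp: smooth_map_def smooth_on_def comp_def)

lemma smooth_map_cong:
  assumes "smooth_map M f" "\<And>x. x \<in> points M \<Longrightarrow> f x = g x"
  shows "smooth_map M g"
proof (rule smooth_mapI)
  fix c k assume c: "c \<in> smooth_charts M" "open (snd c ` fst c)"
  then show "Ck_on k (snd c ` fst c) (\<lambda>y. g (chart_inv c y))"
    using Ck_on_cong[OF c(2), of "\<lambda>y. f (chart_inv c y)" "\<lambda>y. g (chart_inv c y)" k]
      smooth_mapD[OF assms(1) c(1)] chart_inv_in[OF c(1)] assms(2) by blast
qed

lemma smooth_map_const: "smooth_map M (\<lambda>x. c)"
  by (rule smooth_mapI) (rule Ck_on_const)

lemma smooth_map_add:
  "smooth_map M f \<Longrightarrow> smooth_map M g \<Longrightarrow> smooth_map M (\<lambda>x. f x + g x)"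
  by (rule smooth_mapI, rule Ck_on_add) (assumption | erule smooth_mapD)+

lemma smooth_map_linear:
  fixes L :: "'a::euclidean_space \<Rightarrow> 'b::real_normed_vector"
  shows "linear L \<Longrightarrow> smooth_map M f \<Longrightarrow> smooth_map M (\<lambda>x. L (f x))"
  unfolding linear_conv_bounded_linear
  by (rule smooth_mapI, rule Ck_on_bounded_linear[of L]) (assumption | erule smooth_mapD)+

lemma smooth_map_scaleR:
  "smooth_map M a \<Longrightarrow> smooth_map M f \<Longrightarrow> smooth_map M (\<lambda>x. a x *\<^sub>R f x)"
  by (rule smooth_mapI, rule Ck_on_bounded_bilinear[OF bounded_bilinear_scaleR])
    (assumption | erule smooth_mapD)+

lemma smooth_map_mult:
  fixes f g :: "_ \<Rightarrow> real"
  shows "smooth_map M f \<Longrightarrow> smooth_map M g \<Longrightarrow> smooth_map M (\<lambda>x. f x * g x)"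
  using smooth_map_scaleR[of M f g] by simp

lemma smooth_map_diff:
  fixes f g :: "_ \<Rightarrow> real"
  assumes "smooth_map M f" "smooth_map M g"
  shows "smooth_map M (\<lambda>x. f x - g x)"
  using smooth_map_add[OF assms(1) smooth_map_mult[OF smooth_map_const[of M "-1"] assms(2)]] by simp

lemma smooth_map_divide:
  fixes f g :: "_ \<Rightarrow> real"
  assumes "smooth_map M f" "smooth_map M g" "\<And>x. x \<in> points M \<Longrightarrow> g x \<noteq> 0"
  shows "smooth_map M (\<lambda>x. f x / g x)"
proof -
  have "smooth_map M (\<lambda>x. inverse (g x))"
    using assms(3) chart_inv_in smooth_mapD[OF assms(2)]
    by (intro smooth_mapI Ck_on_inverse) blast+
  from smooth_map_mult[OF assms(1) this] show ?thesis
    by (simp add: divide_inverse)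
qed

lemma smooth_map_Pair:
  fixes f :: "_ \<Rightarrow> 'a::euclidean_space" and g :: "_ \<Rightarrow> 'b::euclidean_space"
  assumes "smooth_map M f" "smooth_map M g"
  shows "smooth_map M (\<lambda>x. (f x, g x))"
proof -
  have "linear (\<lambda>v::'a. (v, 0::'b))" "linear (\<lambda>w::'b. (0::'a, w))"
    by (auto intro!: linearI)
  \<comment> \<open>The pair is the sum of its images under the two linear inclusions of the
    factors.\<close>
  then have "smooth_map M (\<lambda>x. (f x, 0) + (0, g x))"
    using assms by (intro smooth_map_add smooth_map_linear[of "\<lambda>v. (v, 0)"]
        smooth_map_linear[of "Pair 0"]) auto
  then show ?thesis by simp
qed

section \<open>The differential\<close>

text \<open>Names the chart that \<open>differential\<close> selects, so that derivative rules can
  be applied in it.\<close>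

definition some_chart :: "('p, 'e::euclidean_space) manifold \<Rightarrow> 'p \<Rightarrow> ('p, 'e) chart" where
  "some_chart M x = (SOME c. c \<in> charts_at M x)"

lemma some_chart:
  assumes "smooth_manifold M" "x \<in> points M"
  shows "some_chart M x \<in> smooth_charts M" "x \<in> fst (some_chart M x)"
proof -
  obtain c where "c \<in> atlas M" "x \<in> fst c"
    using assms unfolding smooth_manifold_def by blast
  then have "c \<in> charts_at M x"
    using assms unfolding smooth_manifold_def charts_at_def smooth_charts_def by blast
  then have "some_chart M x \<in> charts_at M x"
    unfolding some_chart_def by (rule someI)
  then show "some_chart M x \<in> smooth_charts M" "x \<in> fst (some_chart M x)"
    by (auto simp: charts_at_def)
qed

lemma differential_altdef:
  "differential M f x X = frechet_derivative (\<lambda>y. f (chart_inv (some_chart M x) y))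
     (at (snd (some_chart M x) x)) (X (some_chart M x))"
  by (simp add: differential_def some_chart_def Let_def comp_def)

text \<open>Uniqueness of the derivative: every rule for \<open>has_derivative\<close> becomes a
  rule for \<open>differential\<close>.\<close>

lemma differential_eqI:
  assumes "((\<lambda>y. f (chart_inv (some_chart M x) y)) has_derivative D)
     (at (snd (some_chart M x) x))"
  shows "differential M f x X = D (X (some_chart M x))"
  using frechet_derivative_at[OF assms] by (simp add: differential_altdef)

context
  fixes M :: "('p, 'e::euclidean_space) manifold" and x :: 'p
  assumes M: "smooth_manifold M" and x: "x \<in> points M"
begin

lemma smooth_map_has_derivative:
  assumes "smooth_map M f"
  shows "((\<lambda>y. f (chart_inv (some_chart M x) y)) has_derivative
    frechet_derivative (\<lambda>y. f (chart_inv (some_chart M x) y)) (at (snd (some_chart M x) x)))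
     (at (snd (some_chart M x) x))"
  using Ck_on_SucD(1)[OF smooth_mapD[OF assms some_chart(1)[OF M x]]] some_chart(2)[OF M x] by blast

lemma differential_linear:
  fixes L :: "'a::euclidean_space \<Rightarrow> 'b::real_normed_vector"
  assumes "linear L" "smooth_map M f"
  shows "differential M (\<lambda>x. L (f x)) x X = L (differential M f x X)"
  using differential_eqI[OF bounded_linear.has_derivative[OF
      linear_conv_bounded_linear[THEN iffD1, OF assms(1)] smooth_map_has_derivative[OF assms(2)]]]
  by (simp add: differential_altdef)

lemma differential_add:
  assumes "smooth_map M f" "smooth_map M g"
  shows "differential M (\<lambda>x. f x + g x) x X = differential M f x X + differential M g x X"
  using differential_eqI[OF has_derivative_add[OF assms[THEN smooth_map_has_derivative]]]
  by (simp add: differential_altdef)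

lemma differential_scaleR:
  assumes "smooth_map M a" "smooth_map M f"
  shows "differential M (\<lambda>x. a x *\<^sub>R f x) x X =
    a x *\<^sub>R differential M f x X + differential M a x X *\<^sub>R f x"
  using differential_eqI[OF has_derivative_scaleR[OF assms[THEN smooth_map_has_derivative]]]
  by (simp add: differential_altdef chart_inv_apply[OF some_chart[OF M x]])

text \<open>Near the coordinates of \<open>x\<close> the inverse chart takes values in
  \<open>points M\<close> only. This matters because identities between frames hold only on
  \<open>points M\<close>.\<close>

lemma differential_cong:
  assumes "\<And>y. y \<in> points M \<Longrightarrow> f y = g y"
  shows "differential M f x X = differential M g x X"
proof -
  let ?c = "some_chart M x"
  note c = some_chart[OF M x]
  have "frechet_derivative (\<lambda>y. f (chart_inv ?c y)) (at (snd ?c x)) =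
      frechet_derivative (\<lambda>y. g (chart_inv ?c y)) (at (snd ?c x))"
    using c assms chart_inv_in[OF c(1)]
    by (intro frechet_derivative_cong_open[OF smooth_chart_open[OF c(1)]]) auto
  then show ?thesis
    by (simp add: differential_altdef)
qed

end

section \<open>Isotropic planes and projective lines\<close>

lemma span_pair: "span {a, b} = {s *\<^sub>R a + t *\<^sub>R b |s t. True}"
proof -
  have "v \<in> span {a, b} \<longleftrightarrow> (\<exists>s t. v = s *\<^sub>R a + t *\<^sub>R b)" for v
    by (auto simp: span_breakdown_eq diff_eq_eq add.commute)
  then show ?thesis by auto
qed

lemma lin_indep2_iff:
  "lin_indep2 a b \<longleftrightarrow> (\<forall>s t. s *\<^sub>R a + t *\<^sub>R b = 0 \<longrightarrow> s = 0 \<and> t = 0)"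
proof
  assume "lin_indep2 a b"
  then have ab: "a \<noteq> b" "independent {a, b}" by (auto simp: lin_indep2_def)
  show "\<forall>s t. s *\<^sub>R a + t *\<^sub>R b = 0 \<longrightarrow> s = 0 \<and> t = 0"
  proof (intro allI impI)
    fix s t assume "s *\<^sub>R a + t *\<^sub>R b = 0"
    then have "(\<Sum>v\<in>{a, b}. (if v = a then s else t) *\<^sub>R v) = 0"
      using ab(1) by simp
    then have "(if v = a then s else t) = 0" if "v \<in> {a, b}" for v
      using independentD[OF ab(2), of "{a, b}" "\<lambda>v. if v = a then s else t"] that by auto
    from this[of a] this[of b] show "s = 0 \<and> t = 0" using ab(1) by auto
  qed
next
  assume *: "\<forall>s t. s *\<^sub>R a + t *\<^sub>R b = 0 \<longrightarrow> s = 0 \<and> t = 0"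
  have "a \<noteq> b" using *[rule_format, of 1 "-1"] by auto
  moreover have "a \<noteq> t *\<^sub>R b" for t
    using *[rule_format, of 1 "-t"] by auto
  moreover have "b \<noteq> 0" using *[rule_format, of 0 1] by auto
  ultimately show "lin_indep2 a b"
    by (simp add: lin_indep2_def independent_insertI span_singleton image_iff)
qed

lemma proj_eq_iff:
  assumes "v \<noteq> 0"
  shows "proj v = proj w \<longleftrightarrow> (\<exists>t. t \<noteq> 0 \<and> v = t *\<^sub>R w)"
proof
  assume "proj v = proj w"
  then have "v \<in> span {w}"
    using span_base[of v "{v}"] by (simp add: proj_def)
  then show "\<exists>t. t \<noteq> 0 \<and> v = t *\<^sub>R w"
    using assms by (auto simp: span_singleton)
next
  assume "\<exists>t. t \<noteq> 0 \<and> v = t *\<^sub>R w"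
  then obtain t where t: "t \<noteq> 0" "v = t *\<^sub>R w" by blast
  then show "proj v = proj w"
    using span_image_scale[of "{w}" "\<lambda>_. t"] by (simp add: proj_def)
qed

text \<open>A span is closed under rescaling, so the choice of a representative of the projective
  point does not matter.\<close>

lemma proj_in_line_through_iff:
  assumes "v \<noteq> 0"
  shows "proj v \<in> line_through a b \<longleftrightarrow> v \<in> span {a, b}"
proof
  assume "proj v \<in> line_through a b"
  then obtain w t where "w \<in> span {a, b}" "v = t *\<^sub>R w"
    unfolding line_through_def using proj_eq_iff[OF assms] by blast
  then show "v \<in> span {a, b}"
    by (simp only: span_scale)
next
  assume "v \<in> span {a, b}"
  then show "proj v \<in> line_through a b"
    using assms unfolding line_through_def by blast
qed

lemma line_through_eq_iff: "line_through a b = line_through c d \<longleftrightarrow> span {a, b} = span {c, d}"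
proof
  assume eq: "line_through a b = line_through c d"
  have "v \<in> span {a, b} \<longleftrightarrow> v \<in> span {c, d}" for v
    \<comment> \<open>The zero vector represents no projective point, but it lies in both
      spans.\<close>
    by (cases "v = 0") (auto simp: span_0 eq simp flip: proj_in_line_through_iff)
  then show "span {a, b} = span {c, d}" by blast
qed (simp add: line_through_def)

section \<open>The Lie product and its isotropic planes\<close>

lemma lie_altdef: "lie v w = - fst v * fst w + fst (snd v) \<bullet> fst (snd w) - snd (snd v) * snd (snd w)"
  by (cases v; cases w) simp

lemma lie_commute: "lie v w = lie w v"
  by (simp add: lie_altdef inner_commute)

lemma lie_add: "lie (u + v) w = lie u w + lie v w" "lie w (u + v) = lie w u + lie w v"
  by (simp_all add: lie_altdef inner_simps algebra_simps)

lemma lie_scaleR: "lie (t *\<^sub>R v) w = t * lie v w" "lie w (t *\<^sub>R v) = t * lie w v"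
  by (simp_all add: lie_altdef inner_simps algebra_simps)

lemma proj_in_lie_quadric_iff:
  assumes "v \<noteq> 0"
  shows "proj v \<in> lie_quadric \<longleftrightarrow> lie v v = 0"
proof
  assume "proj v \<in> lie_quadric"
  then obtain w t where "lie w w = 0" "v = t *\<^sub>R w"
    unfolding lie_quadric_def using proj_eq_iff[OF assms] by blast
  then show "lie v v = 0"
    by (simp only: lie_scaleR mult_zero_right)
next
  assume "lie v v = 0"
  then show "proj v \<in> lie_quadric"
    using assms unfolding lie_quadric_def by blast
qed

text \<open>The pointwise algebraic part of \<open>legendre_frame\<close>: a basis of a totally
  isotropic plane.\<close>

definition isotropic_pair :: "'k::finite lie_vec \<Rightarrow> 'k lie_vec \<Rightarrow> bool" where
  "isotropic_pair a b \<longleftrightarrow> lin_indep2 a b \<and> lie a a = 0 \<and> lie b b = 0 \<and> lie a b = 0"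

lemma isotropic_pair_span:
  assumes "isotropic_pair a b" "v \<in> span {a, b}" "w \<in> span {a, b}"
  shows "lie v w = 0"
proof -
  obtain s t s' t' where "v = s *\<^sub>R a + t *\<^sub>R b" "w = s' *\<^sub>R a + t' *\<^sub>R b"
    using assms(2,3) unfolding span_pair by blast
  then show ?thesis
    using assms(1) lie_commute[of b a]
    by (simp only: isotropic_pair_def lie_add lie_scaleR) simp
qed

lemma isotropic_pair_line:
  assumes "isotropic_pair a b"
  shows "line_through a b \<in> Lambda"
proof -
  have "line_through a b \<subseteq> lie_quadric"
    using isotropic_pair_span[OF assms] proj_in_lie_quadric_iff unfolding line_through_def by blast
  then show ?thesis
    using assms unfolding Lambda_def isotropic_pair_def by blast
qed

text \<open>A Pluecker coordinate of the plane spanned by \<open>a\<close> and \<open>b\<close>,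
  taken in the two negative coordinate directions of the Lie product.\<close>

definition minor :: "'k::finite lie_vec \<Rightarrow> 'k lie_vec \<Rightarrow> real" where
  "minor a b = fst a * snd (snd b) - fst b * snd (snd a)"

text \<open>The Lie product is positive definite on the vectors whose first and last coordinates
  vanish. An isotropic plane therefore contains no such vector except 0, and it projects injectively
  to these two coordinates.\<close>

lemma isotropic_pair_minor_nonzero:
  assumes ab: "isotropic_pair a b"
  shows "minor a b \<noteq> 0"
proof
  assume det: "minor a b = 0"
  have zero: "s = 0 \<and> t = 0"
    if "s * fst a + t * fst b = 0" "s * snd (snd a) + t * snd (snd b) = 0" for s t
  proof -
    let ?w = "s *\<^sub>R a + t *\<^sub>R b"
    have "?w \<in> span {a, b}" unfolding span_pair by blast
    then have "lie ?w ?w = 0" using isotropic_pair_span[OF ab] by blast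
    then have "?w = 0"
      using that by (auto simp: lie_altdef prod_eq_iff)
    then show ?thesis
      using ab by (auto simp: isotropic_pair_def lin_indep2_iff)
  qed
  \<comment> \<open>If the minor vanishes, its rows supply coefficients that cancel both
    coordinates. By \<open>zero\<close> all four entries are then 0, so that even the coefficients 1
    and 0 cancel both.\<close>
  have "snd (snd b) = 0 \<and> - snd (snd a) = 0"
    using det by (intro zero) (auto simp: minor_def algebra_simps)
  moreover have "fst b = 0 \<and> - fst a = 0"
    using det by (intro zero) (auto simp: minor_def algebra_simps)
  ultimately show False using zero[of 1 0] by simp
qed

text \<open>Cramer's rule for the first and the last coordinate.\<close>

lemma isotropic_pair_coordinates:
  assumes "isotropic_pair a b" "v \<in> span {a, b}"
  shows "v = (minor v b / minor a b) *\<^sub>R a + (minor a v / minor a b) *\<^sub>R b"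
proof -
  obtain s t where v: "v = s *\<^sub>R a + t *\<^sub>R b" using assms(2) by (auto simp: span_pair)
  have "minor v b = s * minor a b" "minor a v = t * minor a b"
    by (simp_all add: v minor_def algebra_simps)
  then show ?thesis
    using isotropic_pair_minor_nonzero[OF assms(1)] v by simp
qed

text \<open>Row reduction gives the basis of the plane with first and last coordinates (1, 0) and
  (0, 1). Isotropy of this basis says exactly that its middle parts are orthogonal unit vectors. The
  coefficients are part of the conclusion because smoothness is later read off from them.\<close>

lemma isotropic_pair_contact_line:
  assumes ab: "isotropic_pair a b"
  obtains e where "e \<in> unit_tangent_bundle" "line_through a b = contact_line e"
    "(1, fst e, 0) = (snd (snd b) / minor a b) *\<^sub>R a + (- snd (snd a) / minor a b) *\<^sub>R b"
    "(0, snd e, 1) = (- fst b / minor a b) *\<^sub>R a + (fst a / minor a b) *\<^sub>R b"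
proof -
  let ?m = "minor a b"
  let ?P = "(snd (snd b) / ?m) *\<^sub>R a + (- snd (snd a) / ?m) *\<^sub>R b"
  let ?X = "(- fst b / ?m) *\<^sub>R a + (fst a / ?m) *\<^sub>R b"
  have m: "?m \<noteq> 0" using isotropic_pair_minor_nonzero[OF ab] .
  define e where "e = (fst (snd ?P), fst (snd ?X))"
  have P: "(1, fst e, 0) = ?P" and X: "(0, snd e, 1) = ?X"
    using m by (simp_all add: e_def prod_eq_iff field_simps) (simp_all add: minor_def)
  have PX: "?P \<in> span {a, b}" "?X \<in> span {a, b}"
    unfolding span_pair by blast+
  have "lie ?P ?P = 0" "lie ?X ?X = 0" "lie ?P ?X = 0"
    using isotropic_pair_span[OF ab] PX by blast+
  then have "e \<in> unit_tangent_bundle"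
    unfolding P[symmetric] X[symmetric]
    by (auto simp: unit_tangent_bundle_def norm_eq_1 case_prod_beta)
  moreover have "span {a, b} = span {?P, ?X}"
  proof -
    have comb: "p *\<^sub>R ?P + q *\<^sub>R ?X =
        ((p * snd (snd b) - q * fst b) / ?m) *\<^sub>R a + ((q * fst a - p * snd (snd a)) / ?m) *\<^sub>R b"
      for p q
      by (simp add: algebra_simps diff_divide_distrib)
    \<comment> \<open>In the reduced basis the coefficients of a vector are its first and last
      coordinates.\<close>
    have "a = fst a *\<^sub>R ?P + snd (snd a) *\<^sub>R ?X" "b = fst b *\<^sub>R ?P + snd (snd b) *\<^sub>R ?X"
      unfolding comb using m by (simp_all add: minor_def mult.commute)
    then have "a \<in> span {?P, ?X}" "b \<in> span {?P, ?X}"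
      unfolding span_pair by blast+
    then show ?thesis
      using PX by (auto simp: span_eq)
  qed
  then have "line_through a b = contact_line e"
    unfolding contact_line_def P X by (simp add: line_through_eq_iff)
  ultimately show ?thesis using that P X by blast
qed

text \<open>Comparing first and last coordinates forces the coefficients (1, 0) and (0, 1), so the
  two reduced bases coincide.\<close>

lemma inj_on_contact_line: "inj_on contact_line unit_tangent_bundle"
proof (rule inj_onI)
  fix d e :: "(real ^ 'k) \<times> (real ^ 'k)"
  assume "contact_line d = contact_line e"
  then have "span {(1, fst d, 0), (0, snd d, 1)} =
      span {(1, fst e, 0), (0, snd e, 1) :: 'k lie_vec}"
    by (simp add: contact_line_def line_through_eq_iff)
  then have "{(1, fst d, 0), (0, snd d, 1)} \<subseteq> (span {(1, fst e, 0), (0, snd e, 1)} :: 'k lie_vec set)"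
    by (metis span_superset)
  then show "d = e"
    by (auto simp: span_pair prod_eq_iff)
qed

section \<open>Lie sphere transformations are conformal\<close>

text \<open>The factor \<open>c\<close> is not normalised to 1, since a linear map inducing a given
  transformation may be multiplied by any nonzero scalar.\<close>

definition conformal_map :: "('k::finite lie_vec \<Rightarrow> 'k lie_vec) \<Rightarrow> bool" where
  "conformal_map B \<longleftrightarrow> linear B \<and> bij B \<and> (\<exists>c. \<forall>v w. lie (B v) (B w) = c * lie v w)"

text \<open>A null vector is a sum of a negative vector \<open>(a, 0, d)\<close> and a positive vector \<open>(0, u, 0)\<close> of
  opposite squares. Replacing \<open>u\<close> by \<open>-u\<close> shows that the two summands remain orthogonal and of
  opposite squares in the pulled back form, so that this form is determined by its value on one unit
  vector \<open>(0, u, 0)\<close>.\<close>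

lemma null_preserving_conformal:
  fixes B :: "'k::finite lie_vec \<Rightarrow> 'k lie_vec"
  assumes "linear B" and null: "\<And>v. lie v v = 0 \<Longrightarrow> lie (B v) (B v) = 0"
  shows "\<exists>c. \<forall>v w. lie (B v) (B w) = c * lie v w"
proof -
  define b where "b v w = lie (B v) (B w)" for v w
  have add: "b (u + v) w = b u w + b v w" "b w (u + v) = b w u + b w v" for u v w
    by (simp_all add: b_def lie_add linear_add[OF assms(1)])
  have scale: "b (t *\<^sub>R v) w = t * b v w" "b w (t *\<^sub>R v) = t * b w v" for t v w
    by (simp_all add: b_def lie_scaleR linear_scale[OF assms(1)])
  have comm: "b v w = b w v" for v w by (simp add: b_def lie_commute)
  have opp: "b (a, 0, d) (0, u, 0) = 0 \<and> b (a, 0, d) (a, 0, d) = - b (0, u, 0) (0, u, 0)"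
    if "a\<^sup>2 + d\<^sup>2 = u \<bullet> u" for a d u
  proof -
    let ?w = "(a, 0, d)" and ?u = "(0, u, 0)"
    have "b (?w + t *\<^sub>R ?u) (?w + t *\<^sub>R ?u) = 0" if "t * t = 1" for t
    proof -
      have "lie (?w + t *\<^sub>R ?u) (?w + t *\<^sub>R ?u) = (t * t) * (u \<bullet> u) - (a\<^sup>2 + d\<^sup>2)"
        by (simp add: power2_eq_square)
      then show ?thesis
        using null \<open>a\<^sup>2 + d\<^sup>2 = u \<bullet> u\<close> that unfolding b_def by simp
    qed
    \<comment> \<open>The difference of the two equations kills the mixed term, and their sum
      relates the squares.\<close>
    from this[of 1] this[of "-1"] show ?thesis
      unfolding add scale by (auto simp: comm[of ?u ?w])
  qed
  obtain e :: "real ^ 'k" where e: "norm e = 1" using vector_choose_size[of 1] by auto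
  define c where "c = b (0, e, 0) (0, e, 0)"
  have e_scale: "b (0, t *\<^sub>R e, 0) (0, t *\<^sub>R e, 0) = t\<^sup>2 * c" for t
    using scale[where t = t and v = "(0, e, 0)"] by (simp add: c_def power2_eq_square)
  have neg: "b (a, 0, d) (a, 0, d) = - ((a\<^sup>2 + d\<^sup>2) * c)" for a d
  proof -
    \<comment> \<open>The multiple of \<open>e\<close> is chosen so that its square balances that of
      \<open>(a, 0, d)\<close>.\<close>
    have "a\<^sup>2 + d\<^sup>2 = (sqrt (a\<^sup>2 + d\<^sup>2) *\<^sub>R e) \<bullet> (sqrt (a\<^sup>2 + d\<^sup>2) *\<^sub>R e)"
      using e by (simp add: norm_eq_1)
    from opp[OF this] show ?thesis by (simp add: e_scale)
  qed
  have pos: "b (0, u, 0) (0, u, 0) = (u \<bullet> u) * c" for u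
    using opp[of "norm u" 0 u] neg[of "norm u" 0] by (simp add: power2_norm_eq_inner)
  have orth: "b (a, 0, d) (0, u, 0) = 0" for a d u
  proof (cases "a\<^sup>2 + d\<^sup>2 = 0")
    case True
    then show ?thesis
      using scale(1)[where t = 0 and v = "(a, 0, d)" and w = "(0, u, 0)"] by (simp add: sum_power2_eq_zero_iff)
  next
    case False
    \<comment> \<open>Scaling by \<open>t\<close> brings \<open>(a, 0, d)\<close> to the length of
      \<open>u\<close>, as \<open>opp\<close> demands; \<open>t\<close> vanishes only for
      \<open>u = 0\<close>.\<close>
    define t where "t = norm u / sqrt (a\<^sup>2 + d\<^sup>2)"
    have "(t * a)\<^sup>2 + (t * d)\<^sup>2 = t\<^sup>2 * (a\<^sup>2 + d\<^sup>2)"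
      by (simp add: algebra_simps power_mult_distrib)
    also have "\<dots> = u \<bullet> u"
      using False by (simp add: t_def power_divide power2_norm_eq_inner)
    finally have "t * b (a, 0, d) (0, u, 0) = 0"
      using opp[of "t * a" "t * d" u] scale(1)[where t = t and v = "(a, 0, d)"] by simp
    moreover have "u = 0" if "t = 0"
      using that False by (auto simp: t_def)
    moreover have "b (a, 0, d) (0, 0, 0) = 0"
      using scale(2)[where t = 0 and v = "(0, 0, 0)"] by simp
    ultimately show ?thesis by auto
  qed
  have square: "b v v = c * lie v v" for v
  proof -
    obtain a u d where v: "v = (a, u, d)" by (cases v)
    have "v = (a, 0, d) + (0, u, 0)" by (simp add: v)
    then have "b v v = b ((a, 0, d) + (0, u, 0)) ((a, 0, d) + (0, u, 0))" by simp
    also have "\<dots> = c * (- a\<^sup>2 + u \<bullet> u - d\<^sup>2)"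
      unfolding add neg pos orth comm[of "(0, u, 0)"] by (simp add: algebra_simps)
    finally show ?thesis by (simp add: v power2_eq_square)
  qed
  \<comment> \<open>Polarization.\<close>
  have "b v w = c * lie v w" for v w
    using square[of "v + w"] square[of v] square[of w] comm[of v w] lie_commute[of v w]
    unfolding add lie_add by (simp add: algebra_simps)
  then show ?thesis unfolding b_def by blast
qed

text \<open>\<open>B\<close> preserves null vectors because \<open>\<beta>\<close> maps the quadric
  into itself, and \<open>inv B\<close> does because \<open>\<beta>\<close> maps it onto itself.
  Having both allows transport in either direction.\<close>

lemma lie_sphere_transformation_conformal:
  assumes "lie_sphere_transformation \<beta>" "induced_by \<beta> B"
  shows "conformal_map B" "conformal_map (inv B)"
proof -
  have quadric: "\<beta> ` lie_quadric = lie_quadric"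
    using assms by (auto simp: lie_sphere_transformation_def)
  have B: "linear B" "bij B" and \<beta>: "\<And>v. v \<noteq> 0 \<Longrightarrow> \<beta> (proj v) = proj (B v)"
    using assms by (auto simp: induced_by_def)
  have nz: "B v = 0 \<longleftrightarrow> v = 0" for v
    using B by (metis bij_is_inj injD linear_0)
  have invB: "B (inv B v) = v" "inv B (B v) = v" for v
    using B by (auto simp: bij_is_inj bij_is_surj surj_f_inv_f)
  have inv_lin: "linear (inv B)"
    using B(1) bij_is_inj[OF B(2)] by (rule inj_linear_imp_inv_linear)
  have "lie (B v) (B v) = 0" if "lie v v = 0" for v
  proof (cases "v = 0")
    case False
    then have "\<beta> (proj v) \<in> lie_quadric"
      using quadric that by (metis image_eqI proj_in_lie_quadric_iff)
    then show ?thesis using False nz \<beta> by (metis proj_in_lie_quadric_iff)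
  qed (use linear_0[OF B(1)] in \<open>simp add: lie_altdef\<close>)
  then show "conformal_map B"
    unfolding conformal_map_def using B null_preserving_conformal[OF B(1)] by blast
  have "lie (inv B v) (inv B v) = 0" if "lie v v = 0" for v
  proof (cases "v = 0")
    case True
    then show ?thesis using that linear_0[OF inv_lin] by simp
  next
    case False
    then have "proj v \<in> \<beta> ` lie_quadric"
      using quadric that proj_in_lie_quadric_iff by blast
    then obtain w where w: "w \<noteq> 0" "lie w w = 0" "proj v = proj (B w)"
      using \<beta> by (auto simp: lie_quadric_def)
    then obtain t where "v = t *\<^sub>R B w"
      using False proj_eq_iff by blast
    then have "inv B v = t *\<^sub>R w"
      using inv_lin by (simp add: linear_scale invB)
    then show ?thesis using w by (simp add: lie_scaleR)
  qed
  then show "conformal_map (inv B)"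
    unfolding conformal_map_def
    using inv_lin bij_imp_bij_inv[OF B(2)] null_preserving_conformal[OF inv_lin] by blast
qed

lemma image_proj:
  fixes B :: "'k::finite lie_vec \<Rightarrow> 'k lie_vec"
  shows "linear B \<Longrightarrow> B ` proj v = proj (B v)"
  using linear_span_image[of B "{v}"] by (simp add: proj_def)

text \<open>Projective points are encoded as subspaces, so the image map of \<open>B\<close> is
  itself a transformation induced by \<open>B\<close>; unlike \<open>\<beta>\<close> it is also
  given by \<open>B\<close> on all other sets.\<close>

lemma induced_by_image:
  fixes B :: "'k::finite lie_vec \<Rightarrow> 'k lie_vec"
  shows "linear B \<Longrightarrow> bij B \<Longrightarrow> induced_by ((`) B) B"
  by (simp add: induced_by_def image_proj)

lemma image_line_through:
  fixes B :: "'k::finite lie_vec \<Rightarrow> 'k lie_vec"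
  assumes "linear B" "bij B"
  shows "(`) B ` line_through a b = line_through (B a) (B b)"
  using lie_transform_line_through[OF induced_by_image[OF assms],
      of "\<lambda>_. line_through a b" undefined "\<lambda>_. a" "\<lambda>_. b"]
  by (simp add: lie_transform_def)

section \<open>Legendre frames\<close>

lemma legendre_frameD:
  assumes "legendre_frame M lam Z1 Z3"
  shows "smooth_map M Z1" "smooth_map M Z3"
    and "\<And>x. x \<in> points M \<Longrightarrow> lam x = line_through (Z1 x) (Z3 x)"
    and "\<And>x. x \<in> points M \<Longrightarrow> isotropic_pair (Z1 x) (Z3 x)"
    and "\<And>x X. x \<in> points M \<Longrightarrow> X \<in> tangent_space M x \<Longrightarrow>
      differential M Z1 x X \<in> span {Z1 x, Z3 x} \<Longrightarrow>
      differential M Z3 x X \<in> span {Z1 x, Z3 x} \<Longrightarrow> X = zero_tangent"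
    and "\<And>x X. x \<in> points M \<Longrightarrow> X \<in> tangent_space M x \<Longrightarrow>
      lie (differential M Z1 x X) (Z3 x) = 0"
  using assms unfolding legendre_frame_def isotropic_pair_def by blast+

lemma smooth_map_lie_vec_coordinates:
  fixes Z :: "'p \<Rightarrow> 'k::finite lie_vec"
  assumes "smooth_map M Z"
  shows "smooth_map M (\<lambda>x. fst (Z x))" "smooth_map M (\<lambda>x. fst (snd (Z x)))"
    and "smooth_map M (\<lambda>x. snd (snd (Z x)))"
proof -
  have "linear (fst :: 'k lie_vec \<Rightarrow> _)" "linear (\<lambda>v :: 'k lie_vec. fst (snd v))"
    "linear (\<lambda>v :: 'k lie_vec. snd (snd v))"
    by (auto intro!: linearI)
  from this[THEN smooth_map_linear[OF _ assms]]
  show "smooth_map M (\<lambda>x. fst (Z x))" "smooth_map M (\<lambda>x. fst (snd (Z x)))"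
    "smooth_map M (\<lambda>x. snd (snd (Z x)))" .
qed

lemma smooth_map_minor:
  assumes "smooth_map M Y" "smooth_map M Z"
  shows "smooth_map M (\<lambda>x. minor (Y x) (Z x))"
  unfolding minor_def
  by (intro smooth_map_diff smooth_map_mult smooth_map_lie_vec_coordinates assms)

text \<open>The reduced basis of each plane has coefficients that are quotients by a nowhere
  vanishing minor, so the contact element varies smoothly. Hence a frame alone suffices for
  \<open>legendre_submanifold\<close>.\<close>

lemma legendre_frame_smooth_map_Lambda:
  fixes lam :: "'p \<Rightarrow> 'k::finite proj_line"
  assumes "legendre_frame M lam Z1 Z3"
  shows "smooth_map_Lambda M lam"
proof -
  note Z = legendre_frameD[OF assms]
  let ?m = "\<lambda>x. minor (Z1 x) (Z3 x)"
  let ?P = "\<lambda>x. (snd (snd (Z3 x)) / ?m x) *\<^sub>R Z1 x + (- snd (snd (Z1 x)) / ?m x) *\<^sub>R Z3 x"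
  let ?X = "\<lambda>x. (- fst (Z3 x) / ?m x) *\<^sub>R Z1 x + (fst (Z1 x) / ?m x) *\<^sub>R Z3 x"
  have m: "smooth_map M ?m" "\<And>x. x \<in> points M \<Longrightarrow> ?m x \<noteq> 0"
    using smooth_map_minor[OF Z(1,2)] isotropic_pair_minor_nonzero[OF Z(4)] by auto
  have neg: "smooth_map M (\<lambda>x. - f x)" if "smooth_map M f" for f :: "'p \<Rightarrow> real"
    using smooth_map_diff[OF smooth_map_const[of M 0] that] by simp
  have "smooth_map M ?P" "smooth_map M ?X"
    by (intro smooth_map_add smooth_map_scaleR smooth_map_divide neg
        smooth_map_lie_vec_coordinates Z(1,2) m; assumption)+
  then have "smooth_map M (\<lambda>x. (fst (snd (?P x)), fst (snd (?X x))))"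
    by (intro smooth_map_Pair smooth_map_lie_vec_coordinates(2))
  then have "smooth_map M (\<lambda>x. inv_into unit_tangent_bundle contact_line (lam x))"
  proof (rule smooth_map_cong)
    fix x assume x: "x \<in> points M"
    obtain e where e: "e \<in> unit_tangent_bundle" "line_through (Z1 x) (Z3 x) = contact_line e"
      "(1, fst e, 0) = ?P x" "(0, snd e, 1) = ?X x"
      using isotropic_pair_contact_line[OF Z(4)[OF x]] by blast
    have "inv_into unit_tangent_bundle contact_line (lam x) = e"
      using inv_into_f_f[OF inj_on_contact_line e(1)] e(2) Z(3)[OF x] by simp
    also have "e = (fst (snd (?P x)), fst (snd (?X x)))"
      by (simp only: prod_eq_iff fst_conv snd_conv flip: e(3,4))
    finally show "(fst (snd (?P x)), fst (snd (?X x))) =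
        inv_into unit_tangent_bundle contact_line (lam x)" ..
  qed
  then show ?thesis
    using Z(3) isotropic_pair_line[OF Z(4)] by (auto simp: smooth_map_Lambda_def)
qed

text \<open>Cramer's rule expresses the coefficients as quotients of minors, which makes them
  smooth.\<close>

lemma legendre_frame_coordinates:
  fixes lam :: "'p \<Rightarrow> 'k::finite proj_line"
  assumes "legendre_frame M lam Z1 Z3" "smooth_map M W"
    and "\<And>x. x \<in> points M \<Longrightarrow> W x \<in> span {Z1 x, Z3 x}"
  obtains a b where "smooth_map M a" "smooth_map M b"
    "\<And>x. x \<in> points M \<Longrightarrow> W x = a x *\<^sub>R Z1 x + b x *\<^sub>R Z3 x"
proof -
  note Z = legendre_frameD[OF assms(1)]
  show thesis
  proof (rule that)
    show "smooth_map M (\<lambda>x. minor (W x) (Z3 x) / minor (Z1 x) (Z3 x))"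
      "smooth_map M (\<lambda>x. minor (Z1 x) (W x) / minor (Z1 x) (Z3 x))"
      using isotropic_pair_minor_nonzero[OF Z(4)]
      by (auto intro!: smooth_map_divide smooth_map_minor Z(1,2) assms(2))
  qed (use isotropic_pair_coordinates Z(4) assms(3) in blast)
qed

text \<open>A single nonzero principal vector determines the curvature sphere, whichever frames are
  used. The second sphere is rewritten in the frame \<open>Z1\<close>, \<open>Z3\<close>; if it
  differed from the first, both \<open>Z1\<close> and \<open>Z3\<close> would have differentials
  along \<open>X\<close> inside the plane, against the immersion condition.\<close>

lemma curvature_sphere_frame_unique:
  assumes M: "smooth_manifold M" and x: "x \<in> points M"
    and Z: "legendre_frame M lam Z1 Z3" and W: "legendre_frame M lam W1 W3"
    and X: "X \<in> tangent_space M x" "X \<noteq> zero_tangent"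
    and rs: "(r, s) \<noteq> (0, 0)"
      "r *\<^sub>R differential M Z1 x X + s *\<^sub>R differential M Z3 x X \<in> span {Z1 x, Z3 x}"
    and rs': "(r', s') \<noteq> (0, 0)"
      "r' *\<^sub>R differential M W1 x X + s' *\<^sub>R differential M W3 x X \<in> span {W1 x, W3 x}"
  shows "proj (r *\<^sub>R Z1 x + s *\<^sub>R Z3 x) = proj (r' *\<^sub>R W1 x + s' *\<^sub>R W3 x)"
proof -
  note Zs = legendre_frameD[OF Z] and Ws = legendre_frameD[OF W]
  let ?S = "span {Z1 x, Z3 x}"
  let ?dZ1 = "differential M Z1 x X" and ?dZ3 = "differential M Z3 x X"
  have span_eq: "span {W1 y, W3 y} = span {Z1 y, Z3 y}" if "y \<in> points M" for y
    using that Zs(3) Ws(3) by (metis line_through_eq_iff)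
  \<comment> \<open>By the product rule, differentiating the coefficients contributes only vectors
    of the plane, so modulo \<open>?S\<close> the differential transforms like the vector
    itself.\<close>
  have modulo: "\<exists>a b. V x = a *\<^sub>R Z1 x + b *\<^sub>R Z3 x \<and>
      differential M V x X - (a *\<^sub>R ?dZ1 + b *\<^sub>R ?dZ3) \<in> ?S"
    if V: "smooth_map M V" "\<And>y. y \<in> points M \<Longrightarrow> V y \<in> span {Z1 y, Z3 y}" for V
  proof -
    obtain a b where ab: "smooth_map M a" "smooth_map M b"
      "\<And>y. y \<in> points M \<Longrightarrow> V y = a y *\<^sub>R Z1 y + b y *\<^sub>R Z3 y"
      using legendre_frame_coordinates[OF Z V] by blast
    have "differential M V x X = differential M (\<lambda>y. a y *\<^sub>R Z1 y + b y *\<^sub>R Z3 y) x X"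
      using ab(3) by (rule differential_cong[OF M x])
    also have "\<dots> = (a x *\<^sub>R ?dZ1 + differential M a x X *\<^sub>R Z1 x) +
        (b x *\<^sub>R ?dZ3 + differential M b x X *\<^sub>R Z3 x)"
      using ab(1,2) Zs(1,2)
      by (simp add: differential_add[OF M x] differential_scaleR[OF M x] smooth_map_scaleR)
    finally have "differential M V x X - (a x *\<^sub>R ?dZ1 + b x *\<^sub>R ?dZ3) =
        differential M a x X *\<^sub>R Z1 x + differential M b x X *\<^sub>R Z3 x"
      by simp
    then show ?thesis
      using ab(3)[OF x] unfolding span_pair by blast
  qed
  have W_in: "W1 y \<in> span {Z1 y, Z3 y}" "W3 y \<in> span {Z1 y, Z3 y}" if "y \<in> points M" for y
    using span_eq[OF that] by (metis span_base insertI1 insertI2)+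
  obtain a b where ab: "W1 x = a *\<^sub>R Z1 x + b *\<^sub>R Z3 x"
    "differential M W1 x X - (a *\<^sub>R ?dZ1 + b *\<^sub>R ?dZ3) \<in> ?S"
    using modulo[OF Ws(1) W_in(1)] by blast
  obtain c d where cd: "W3 x = c *\<^sub>R Z1 x + d *\<^sub>R Z3 x"
    "differential M W3 x X - (c *\<^sub>R ?dZ1 + d *\<^sub>R ?dZ3) \<in> ?S"
    using modulo[OF Ws(2) W_in(2)] by blast
  \<comment> \<open>The homogeneous coordinates of the second sphere in the frame \<open>Z1\<close>,
    \<open>Z3\<close>.\<close>
  define \<rho> \<sigma> where "\<rho> = r' * a + s' * c" and "\<sigma> = r' * b + s' * d"
  have K: "r' *\<^sub>R W1 x + s' *\<^sub>R W3 x = \<rho> *\<^sub>R Z1 x + \<sigma> *\<^sub>R Z3 x"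
    by (simp add: ab cd \<rho>_def \<sigma>_def algebra_simps)
  have "\<rho> *\<^sub>R ?dZ1 + \<sigma> *\<^sub>R ?dZ3 = (r' *\<^sub>R differential M W1 x X + s' *\<^sub>R differential M W3 x X)
      - (r' *\<^sub>R (differential M W1 x X - (a *\<^sub>R ?dZ1 + b *\<^sub>R ?dZ3))
       + s' *\<^sub>R (differential M W3 x X - (c *\<^sub>R ?dZ1 + d *\<^sub>R ?dZ3)))"
    by (simp add: \<rho>_def \<sigma>_def algebra_simps)
  then have dK: "\<rho> *\<^sub>R ?dZ1 + \<sigma> *\<^sub>R ?dZ3 \<in> ?S"
    using span_diff[OF rs'(2)[unfolded span_eq[OF x]]
        span_add[OF span_scale[OF ab(2), of r'] span_scale[OF cd(2), of s']]]
    by (simp only:)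
  have "r * \<sigma> = s * \<rho>"
  proof (rule ccontr)
    assume ne: "r * \<sigma> \<noteq> s * \<rho>"
    let ?D = "r * \<sigma> - s * \<rho>"
    have cancel: "v \<in> ?S" if "?D *\<^sub>R v \<in> ?S" for v
      using span_scale[OF that, of "inverse ?D"] ne by simp
    \<comment> \<open>With nonzero determinant \<open>?D\<close>, the two memberships can be solved
      for the two differentials.\<close>
    have "?D *\<^sub>R ?dZ1 = \<sigma> *\<^sub>R (r *\<^sub>R ?dZ1 + s *\<^sub>R ?dZ3) - s *\<^sub>R (\<rho> *\<^sub>R ?dZ1 + \<sigma> *\<^sub>R ?dZ3)"
      "?D *\<^sub>R ?dZ3 = r *\<^sub>R (\<rho> *\<^sub>R ?dZ1 + \<sigma> *\<^sub>R ?dZ3) - \<rho> *\<^sub>R (r *\<^sub>R ?dZ1 + s *\<^sub>R ?dZ3)"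
      by (simp_all add: algebra_simps)
    then have "?D *\<^sub>R ?dZ1 \<in> ?S" "?D *\<^sub>R ?dZ3 \<in> ?S"
      using span_diff[OF span_scale[OF rs(2), of \<sigma>] span_scale[OF dK, of s]]
        span_diff[OF span_scale[OF dK, of r] span_scale[OF rs(2), of \<rho>]]
      by (simp_all only:)
    then have "?dZ1 \<in> ?S" "?dZ3 \<in> ?S"
      using cancel by blast+
    then show False using Zs(5)[OF x X(1)] X(2) by blast
  qed
  moreover have nz: "r' *\<^sub>R W1 x + s' *\<^sub>R W3 x \<noteq> 0"
    using Ws(4)[OF x] rs'(1) by (auto simp: isotropic_pair_def lin_indep2_iff)
  ultimately have "\<exists>t. \<rho> = t * r \<and> \<sigma> = t * s"
    \<comment> \<open>The factor comes from whichever of \<open>r\<close> and \<open>s\<close> is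
      nonzero.\<close>
    using rs(1) by (intro exI[of _ "if r = 0 then \<sigma> / s else \<rho> / r"]) (auto simp: field_simps)
  then obtain t where t: "\<rho> = t * r" "\<sigma> = t * s" by blast
  then have "r' *\<^sub>R W1 x + s' *\<^sub>R W3 x = t *\<^sub>R (r *\<^sub>R Z1 x + s *\<^sub>R Z3 x)"
    by (simp add: K algebra_simps)
  moreover from this nz have "t \<noteq> 0" by auto
  ultimately show ?thesis
    using proj_eq_iff[OF nz] by metis
qed

text \<open>A curvature sphere has a nonzero principal vector, and by equality of the spaces this
  vector also belongs to \<open>\<mu>\<close>.\<close>

lemma curvature_sphere_unique:
  assumes "smooth_manifold M" "x \<in> points M"
    and \<kappa>: "curvature_sphere M lam x \<kappa>" and eq: "principal_space M lam x \<kappa> = principal_space M lam x \<mu>"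
  shows "\<kappa> = \<mu>"
proof -
  obtain Z1 Z3 r s X where Z: "legendre_frame M lam Z1 Z3" "(r, s) \<noteq> (0, 0)"
    "\<kappa> = proj (r *\<^sub>R Z1 x + s *\<^sub>R Z3 x)" "X \<in> tangent_space M x" "X \<noteq> zero_tangent"
    "r *\<^sub>R differential M Z1 x X + s *\<^sub>R differential M Z3 x X \<in> span {Z1 x, Z3 x}"
    using \<kappa> unfolding curvature_sphere_def by blast
  then have "X \<in> principal_space M lam x \<kappa>"
    unfolding principal_space_def by blast
  then have "X \<in> principal_space M lam x \<mu>"
    by (simp only: eq)
  then obtain W1 W3 r' s' where "legendre_frame M lam W1 W3" "(r', s') \<noteq> (0, 0)"
    "\<mu> = proj (r' *\<^sub>R W1 x + s' *\<^sub>R W3 x)"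
    "r' *\<^sub>R differential M W1 x X + s' *\<^sub>R differential M W3 x X \<in> span {W1 x, W3 x}"
    unfolding principal_space_def by blast
  from curvature_sphere_frame_unique[OF assms(1,2) Z(1) this(1), OF Z(4,5,2,6) this(2,4)]
    this(3) Z(3)
  show ?thesis by simp
qed

lemma curvature_sphere_map_eqI:
  assumes "smooth_manifold M" "x \<in> points M" "curvature_sphere M lam x \<kappa>"
    and "submanifold_tangent_space M S x = principal_space M lam x \<kappa>"
  shows "curvature_sphere_map M lam S x = \<kappa>"
  unfolding curvature_sphere_map_def
proof (rule the_equality)
  fix \<mu> assume "curvature_sphere M lam x \<mu> \<and>
    submanifold_tangent_space M S x = principal_space M lam x \<mu>"
  then show "\<mu> = \<kappa>"
    using curvature_sphere_unique[OF assms(1-3), of \<mu>] assms(4) by simp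
qed (use assms in simp)

section \<open>Transport by conformal maps\<close>

text \<open>Conformality of both \<open>B\<close> and \<open>inv B\<close> makes the relation
  symmetric, and \<open>lam'\<close> is prescribed only at the points of \<open>M\<close>.\<close>

locale lie_equivalent =
  fixes M :: "('p, 'e::euclidean_space) manifold"
    and B :: "'k::finite lie_vec \<Rightarrow> 'k lie_vec"
    and lam lam' :: "'p \<Rightarrow> 'k proj_line"
  assumes M: "smooth_manifold M"
    and conformal: "conformal_map B" "conformal_map (inv B)"
    and lam': "\<And>x. x \<in> points M \<Longrightarrow> lam' x = (`) B ` lam x"
begin

lemma lin: "linear B" and bij: "bij B"
  using conformal unfolding conformal_map_def by blast+

lemma span_iff: "B v \<in> span {B a, B b} \<longleftrightarrow> v \<in> span {a, b}"
proof -
  have "span {B a, B b} = B ` span {a, b}"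
    using linear_span_image[OF lin, of "{a, b}"] by simp
  then show ?thesis
    by (simp only: inj_image_mem_iff[OF bij_is_inj[OF bij]])
qed

text \<open>A linear map commutes with the differential and, being bijective, preserves and reflects
  membership in spans; the conformal factor does not affect vanishing Lie products.\<close>

lemma frame:
  assumes "legendre_frame M lam Z1 Z3"
  shows "legendre_frame M lam' (\<lambda>x. B (Z1 x)) (\<lambda>x. B (Z3 x))"
proof -
  note Z = legendre_frameD[OF assms]
  obtain c where c: "\<And>v w. lie (B v) (B w) = c * lie v w"
    using conformal(1) unfolding conformal_map_def by blast
  have B0: "B v = 0 \<longleftrightarrow> v = 0" for v
    using lin bij by (metis bij_is_inj injD linear_0)
  have indep: "lin_indep2 (B a) (B b)" if "lin_indep2 a b" for a b
    using that by (simp add: lin_indep2_iff B0 flip: linear_scale[OF lin] linear_add[OF lin])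
  show ?thesis
    unfolding legendre_frame_def
  proof (intro conjI ballI notI)
    show "smooth_map M (\<lambda>x. B (Z1 x))" "smooth_map M (\<lambda>x. B (Z3 x))"
      by (rule smooth_map_linear[OF lin Z(1)], rule smooth_map_linear[OF lin Z(2)])
  next
    fix x assume x: "x \<in> points M"
    show "lam' x = line_through (B (Z1 x)) (B (Z3 x))"
      by (simp add: lam'[OF x] Z(3)[OF x] image_line_through[OF lin bij])
    show "lin_indep2 (B (Z1 x)) (B (Z3 x))" "lie (B (Z1 x)) (B (Z1 x)) = 0"
      "lie (B (Z3 x)) (B (Z3 x)) = 0" "lie (B (Z1 x)) (B (Z3 x)) = 0"
      using Z(4)[OF x] indep by (simp_all add: isotropic_pair_def c)
    show "lie (differential M (\<lambda>x. B (Z1 x)) x X) (B (Z3 x)) = 0" if "X \<in> tangent_space M x" for X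
      using Z(6)[OF x that] by (simp add: differential_linear[OF M x lin Z(1)] c)
    show False if "\<exists>X\<in>tangent_space M x. X \<noteq> zero_tangent \<and>
        differential M (\<lambda>x. B (Z1 x)) x X \<in> span {B (Z1 x), B (Z3 x)} \<and>
        differential M (\<lambda>x. B (Z3 x)) x X \<in> span {B (Z1 x), B (Z3 x)}"
      using that Z(5)[OF x]
      unfolding differential_linear[OF M x lin Z(1)] differential_linear[OF M x lin Z(2)] span_iff
      by blast
  qed
qed

lemma transported_combination:
  assumes "legendre_frame M lam Z1 Z3" "x \<in> points M"
  shows "r *\<^sub>R differential M (\<lambda>x. B (Z1 x)) x X + s *\<^sub>R differential M (\<lambda>x. B (Z3 x)) x X
      \<in> span {B (Z1 x), B (Z3 x)} \<longleftrightarrow>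
    r *\<^sub>R differential M Z1 x X + s *\<^sub>R differential M Z3 x X \<in> span {Z1 x, Z3 x}"
  using legendre_frameD(1,2)[OF assms(1)]
  by (simp add: differential_linear[OF M assms(2) lin] span_iff
      flip: linear_scale[OF lin] linear_add[OF lin])

lemma image_proj_combination:
  "B ` proj (r *\<^sub>R v + s *\<^sub>R w) = proj (r *\<^sub>R B v + s *\<^sub>R B w)"
  by (simp add: image_proj[OF lin] linear_scale[OF lin] linear_add[OF lin])

lemma curvature_sphere_image:
  assumes "x \<in> points M" "curvature_sphere M lam x \<kappa>"
  shows "curvature_sphere M lam' x (B ` \<kappa>)"
proof -
  obtain Z1 Z3 r s X where Z: "legendre_frame M lam Z1 Z3" "(r, s) \<noteq> (0, 0)"
    "\<kappa> = proj (r *\<^sub>R Z1 x + s *\<^sub>R Z3 x)" "X \<in> tangent_space M x" "X \<noteq> zero_tangent"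
    "r *\<^sub>R differential M Z1 x X + s *\<^sub>R differential M Z3 x X \<in> span {Z1 x, Z3 x}"
    using assms(2) unfolding curvature_sphere_def by blast
  then show ?thesis
    unfolding curvature_sphere_def
    using frame[OF Z(1)] transported_combination[OF Z(1) assms(1), of r X s]
      image_proj_combination[of r "Z1 x" s "Z3 x"] by blast
qed

lemma principal_space_subset:
  assumes "x \<in> points M"
  shows "principal_space M lam x \<kappa> \<subseteq> principal_space M lam' x (B ` \<kappa>)"
proof
  fix X assume "X \<in> principal_space M lam x \<kappa>"
  then obtain Z1 Z3 r s where Z: "X \<in> tangent_space M x" "legendre_frame M lam Z1 Z3"
    "(r, s) \<noteq> (0, 0)" "\<kappa> = proj (r *\<^sub>R Z1 x + s *\<^sub>R Z3 x)"
    "r *\<^sub>R differential M Z1 x X + s *\<^sub>R differential M Z3 x X \<in> span {Z1 x, Z3 x}"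
    unfolding principal_space_def by blast
  then show "X \<in> principal_space M lam' x (B ` \<kappa>)"
    unfolding principal_space_def
    using frame[OF Z(2)] transported_combination[OF Z(2) assms, of r X s]
      image_proj_combination[of r "Z1 x" s "Z3 x"] by blast
qed

lemma inv_image: "inv B ` B ` A = A" "B ` inv B ` A = A"
  using bij by (simp_all add: image_inv_f_f image_f_inv_f bij_is_inj bij_is_surj)

end

text \<open>Turns each one-sided transport result into an equivalence or an equality.\<close>

lemma lie_equivalent_sym:
  assumes "lie_equivalent M B lam lam'"
  shows "lie_equivalent M (inv B) lam' lam"
proof -
  interpret lie_equivalent M B lam lam' by fact
  show ?thesis
  proof
    show "smooth_manifold M" by (rule M)
    show "conformal_map (inv B)" "conformal_map (inv (inv B))"
      using conformal by (simp_all add: inv_inv_eq[OF bij])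
    show "lam x = (`) (inv B) ` lam' x" if "x \<in> points M" for x
      by (simp only: lam'[OF that] image_image[of "(`) (inv B)"] inv_image image_ident)
  qed
qed

context lie_equivalent
begin

lemmas inverse = lie_equivalent_sym[OF lie_equivalent_axioms]

lemma curvature_sphere_iff:
  assumes "x \<in> points M"
  shows "curvature_sphere M lam' x (B ` \<kappa>) \<longleftrightarrow> curvature_sphere M lam x \<kappa>"
  using curvature_sphere_image[OF assms] lie_equivalent.curvature_sphere_image[OF inverse assms, of "B ` \<kappa>"]
  by (auto simp: inv_image)

lemma curvature_spheres_eq:
  assumes "x \<in> points M"
  shows "{\<kappa>. curvature_sphere M lam' x \<kappa>} = (`) B ` {\<kappa>. curvature_sphere M lam x \<kappa>}"
proof -
  have "\<kappa> \<in> (`) B ` {\<kappa>. curvature_sphere M lam x \<kappa>}" if "curvature_sphere M lam' x \<kappa>" for \<kappa>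
    using that curvature_sphere_iff[OF assms, of "inv B ` \<kappa>"]
    by (intro image_eqI[of _ _ "inv B ` \<kappa>"]) (simp_all add: inv_image)
  then show ?thesis
    using curvature_sphere_iff[OF assms] by auto
qed

lemma principal_space_eq:
  assumes "x \<in> points M"
  shows "principal_space M lam' x (B ` \<kappa>) = principal_space M lam x \<kappa>"
  using principal_space_subset[OF assms, of \<kappa>]
    lie_equivalent.principal_space_subset[OF inverse assms, of "B ` \<kappa>"]
  by (simp add: inv_image)

text \<open>Being a connected submanifold does not involve the Legendre map, and the principal space
  of a sphere equals that of its image.\<close>

lemma curvature_surface_imp:
  assumes "curvature_surface M lam S"
  shows "curvature_surface M lam' S"
  using assms curvature_sphere_image principal_space_eq
  unfolding curvature_surface_def submanifold_def
  by (metis subsetD)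

lemma curvature_sphere_map_eq:
  assumes S: "curvature_surface M lam S" and "x \<in> S"
  shows "curvature_sphere_map M lam' S x = B ` curvature_sphere_map M lam S x"
proof -
  have x: "x \<in> points M"
    using assms unfolding curvature_surface_def submanifold_def by blast
  obtain \<kappa> where \<kappa>: "curvature_sphere M lam x \<kappa>"
    "submanifold_tangent_space M S x = principal_space M lam x \<kappa>"
    using assms unfolding curvature_surface_def by blast
  have "curvature_sphere_map M lam S x = \<kappa>"
    using \<kappa> by (rule curvature_sphere_map_eqI[OF M x])
  moreover have "curvature_sphere_map M lam' S x = B ` \<kappa>"
    using \<kappa>(2) curvature_sphere_map_eqI[OF M x curvature_sphere_image[OF x \<kappa>(1)]]
    by (simp only: principal_space_eq[OF x])
  ultimately show ?thesis by simp
qed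

lemma dupin_imp:
  assumes "dupin M lam"
  shows "dupin M lam'"
  unfolding dupin_def
proof (intro conjI allI impI)
  obtain Z1 Z3 where "legendre_frame M lam Z1 Z3"
    using assms unfolding dupin_def legendre_submanifold_def by blast
  from frame[OF this] show "legendre_submanifold M lam'"
    using legendre_frame_smooth_map_Lambda unfolding legendre_submanifold_def by blast
next
  fix S assume "curvature_surface M lam' S"
  \<comment> \<open>The Dupin condition is known only for \<open>lam\<close>, so surfaces of
    \<open>lam'\<close> are carried back by the inverse.\<close>
  then have S: "curvature_surface M lam S" by (rule lie_equivalent.curvature_surface_imp[OF inverse])
  then have "curvature_sphere_map M lam S constant_on S"
    using assms unfolding dupin_def by blast
  then show "curvature_sphere_map M lam' S constant_on S"
    using curvature_sphere_map_eq[OF S] unfolding constant_on_def by metis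
qed

lemma proper_dupin_imp:
  assumes "proper_dupin M lam"
  shows "proper_dupin M lam'"
proof -
  have "inj_on ((`) B) A" for A
    by (metis inj_onI inv_image(1))
  then have "finite {\<kappa>. curvature_sphere M lam' x \<kappa>} = finite {\<kappa>. curvature_sphere M lam x \<kappa>}"
    "card {\<kappa>. curvature_sphere M lam' x \<kappa>} = card {\<kappa>. curvature_sphere M lam x \<kappa>}"
    if "x \<in> points M" for x
    by (simp_all add: curvature_spheres_eq[OF that] card_image finite_image_iff)
  then show ?thesis
    using assms dupin_imp unfolding proper_dupin_def by auto
qed

end

text \<open>All elements of a projective line are classes of nonzero vectors, and there
  \<open>\<beta>\<close> agrees with the image map of \<open>B\<close>.\<close>

lemma lie_transform_lie_equivalent:
  assumes "smooth_manifold M" "legendre_submanifold M lam"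
    and "lie_sphere_transformation \<beta>" "induced_by \<beta> B"
  shows "lie_equivalent M B lam (lie_transform \<beta> lam)"
proof
  show "smooth_manifold M" "conformal_map B" "conformal_map (inv B)"
    using assms lie_sphere_transformation_conformal by blast+
  fix x assume x: "x \<in> points M"
  obtain Z1 Z3 where "lam x = line_through (Z1 x) (Z3 x)"
    using assms(2) x legendre_frameD(3) unfolding legendre_submanifold_def by metis
  then show "lie_transform \<beta> lam x = (`) B ` lam x"
    using assms(4) lie_transform_line_through[OF assms(4)]
    by (simp add: image_line_through induced_by_def)
qed

theorem theorem8p1:
  fixes M :: "('p, real ^ 'm) manifold"
    and lam :: "'p \<Rightarrow> 'k::finite proj_line"
    and \<beta> :: "'k proj_point \<Rightarrow> 'k proj_point"
    and n :: nat
  assumes "n \<ge> 2"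
    and "CARD('m) = n - 1"
    and "CARD('k) = n + 1"
    and "smooth_manifold M"
    and "legendre_submanifold M lam"
    and "lie_sphere_transformation \<beta>"
  shows "(dupin M lam \<longrightarrow> dupin M (lie_transform \<beta> lam)) \<and>
         (proper_dupin M lam \<longrightarrow> proper_dupin M (lie_transform \<beta> lam))"
proof -
  obtain B where "induced_by \<beta> B"
    using assms(6) unfolding lie_sphere_transformation_def by blast
  then interpret lie_equivalent M B lam "lie_transform \<beta> lam"
    using lie_transform_lie_equivalent assms by blast
  show ?thesis
    using dupin_imp proper_dupin_imp by blast
qed

end
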